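(* The equations of motion $$\frac{d}{dt}\frac{\partial \mathcal L^*}{\partial\dot q_r}-\frac{\partial\mathcal L^*}{\partial q_r}-\sum_{\nu=1}^k\frac{\partial\mathcal L^*}{\partial q_{m+\nu}}\frac{\partial\alpha_\nu}{\partial\dot q_r}-\sum_{\nu=1}^k B_r^\nu\,\frac{\partial T}{\partial\dot q_{m+\nu}}=0,\qquad r=1,\dots,m,$$ together with $\dot q_{m+\nu}=\alpha_\nu(q_1,\dots,q_n,\dot q_1,\dots,\dot q_m,t)$, $\nu=1,\dots,k$, imply the relation (along every motion $q(t)$ satisfying them) $$\frac{d}{dt}\left(\sum_{r=1}^m\dot q_r\frac{\partial\mathcal L^*}{\partial\dot q_r}-\mathcal L^*\right)=-\frac{\partial\mathcal L^*}{\partial t}+\sum_{\nu=1}^k(\overline\alpha_\nu-\alpha_\nu)\frac{\partial\mathcal L^*}{\partial q_{m+\nu}}+\sum_{\nu=1}^k\overline B_\nu\,\frac{\partial T}{\partial\dot q_{m+\nu}},$$ where $$\overline\alpha_\nu=\sum_{r=1}^m\frac{\partial\alpha_\nu}{\partial\dot q_r}\dot q_r,\qquad \overline B_\nu=\sum_{r=1}^m B_r^\nu\,\dot q_r,\qquad \nu=1,\dots,k.$$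
   Context: A mechanical system has Lagrangian coordinates $q=(q_1,\dots,q_n)$, generalized velocities $\dot q=(\dot q_1,\dots,\dot q_n)$ and kinetic energy $T(q,\dot q,t)$; the generalized forces are $\partial U/\partial q_i$ for a function $U(q,t)$. It is subject to $k<n$ kinematic constraints written in explicit form $\dot q_{m+\nu}=\alpha_\nu(q_1,\dots,q_n,\dot q_1,\dots,\dot q_m,t)$, $\nu=1,\dots,k$, with $m=n-k$. The restricted kinetic energy is $$T^*(q_1,\dots,q_n,\dot q_1,\dots,\dot q_m,t)=T(q_1,\dots,q_n,\dot q_1,\dots,\dot q_m,\alpha_1,\dots,\alpha_k,t),$$ where each $\alpha_\nu$ is evaluated at $(q_1,\dots,q_n,\dot q_1,\dots,\dot q_m,t)$, and the restricted Lagrangian is $\mathcal L^*=T^*+U$, a function of $(q_1,\dots,q_n,\dot q_1,\dots,\dot q_m,t)$. The coefficients $B_r^\nu$ are $$B_r^\nu=\frac{d}{dt}\left(\frac{\partial\alpha_\nu}{\partial\dot q_r}\right)-\frac{\partial\alpha_\nu}{\partial q_r}-\sum_{\mu=1}^k\frac{\partial\alpha_\mu}{\partial\dot q_r}\frac{\partial\alpha_\nu}{\partial q_{m+\mu}},\qquad r=1,\dots,m,\ \nu=1,\dots,k.$$ Here $d/dt$ is the total time derivative along the motion (with $\dot q_{m+\nu}=\alpha_\nu$), and $\partial T/\partial\dot q_{m+\nu}$ is computed from $T(q,\dot q,t)$ and then evaluated at $\dot q_{m+\mu}=\alpha_\mu$, $\mu=1,\dots,k$. All functions are assumed as smooth as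 needed, and motions $q(t)$ are twice continuously differentiable. *)

theory Defs
  imports "HOL-Analysis.Analysis"
begin

text \<open>
  The index type \<open>'m + 'k\<close> splits the coordinates: \<open>Inl r\<close> is the index of \<open>q\<^sub>r\<close>
  (independent velocities), \<open>Inr \<nu>\<close> that of \<open>q\<^bsub>m+\<nu>\<^esub>\<close> (velocities given by the constraints).
  Functions of the mechanical state are curried as \<open>F q v t\<close>, where \<open>v\<close> holds either all the
  velocities or only the independent ones.
\<close>

definition C1_on :: "'a::real_normed_vector set \<Rightarrow> ('a \<Rightarrow> 'b::real_normed_vector) \<Rightarrow> bool" where
  "C1_on S f \<longleftrightarrow>
     (\<exists>f'. (\<forall>x\<in>S. (f has_derivative blinfun_apply (f' x)) (at x)) \<and> continuous_on S f')"

definition C2_on :: "'a::real_normed_vector set \<Rightarrow> ('a \<Rightarrow> 'b::real_normed_vector) \<Rightarrow> bool" where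
  "C2_on S f \<longleftrightarrow>
     (\<exists>f'. (\<forall>x\<in>S. (f has_derivative blinfun_apply (f' x)) (at x)) \<and> C1_on S f')"

definition partial :: "'i::finite \<Rightarrow> (real^'i \<Rightarrow> real) \<Rightarrow> real^'i \<Rightarrow> real" where
  "partial i f x = deriv (\<lambda>s. f (\<chi> j. if j = i then s else x $ j)) (x $ i)"

definition D_pos ::
  "'i::finite \<Rightarrow> (real^'i \<Rightarrow> real^'j \<Rightarrow> real \<Rightarrow> real) \<Rightarrow> real^'i \<Rightarrow> real^'j \<Rightarrow> real \<Rightarrow> real" where
  "D_pos i F q v t = partial i (\<lambda>x. F x v t) q"

definition D_vel ::
  "'j::finite \<Rightarrow> (real^'i \<Rightarrow> real^'j \<Rightarrow> real \<Rightarrow> real) \<Rightarrow> real^'i \<Rightarrow> real^'j \<Rightarrow> real \<Rightarrow> real" where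
  "D_vel j F q v t = partial j (\<lambda>w. F q w t) v"

definition D_time ::
  "(real^'i \<Rightarrow> real^'j \<Rightarrow> real \<Rightarrow> real) \<Rightarrow> real^'i \<Rightarrow> real^'j \<Rightarrow> real \<Rightarrow> real" where
  "D_time F q v t = deriv (\<lambda>s. F q v s) t"

definition join :: "real^'m \<Rightarrow> real^'k \<Rightarrow> real^('m::finite + 'k::finite)" where
  "join v w = (\<chi> i. case i of Inl r \<Rightarrow> v $ r | Inr \<nu> \<Rightarrow> w $ \<nu>)"

definition restrict_vel ::
  "(real^('m::finite + 'k::finite) \<Rightarrow> real^'m \<Rightarrow> real \<Rightarrow> real^'k) \<Rightarrow>
   (real^('m + 'k) \<Rightarrow> real^('m + 'k) \<Rightarrow> real \<Rightarrow> real) \<Rightarrow>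
   real^('m + 'k) \<Rightarrow> real^'m \<Rightarrow> real \<Rightarrow> real" where
  "restrict_vel \<alpha> F q v t = F q (join v (\<alpha> q v t)) t"

definition restricted_Lagrangian ::
  "(real^('m::finite + 'k::finite) \<Rightarrow> real^('m + 'k) \<Rightarrow> real \<Rightarrow> real) \<Rightarrow>
   (real^('m + 'k) \<Rightarrow> real \<Rightarrow> real) \<Rightarrow>
   (real^('m + 'k) \<Rightarrow> real^'m \<Rightarrow> real \<Rightarrow> real^'k) \<Rightarrow>
   real^('m + 'k) \<Rightarrow> real^'m \<Rightarrow> real \<Rightarrow> real" where
  "restricted_Lagrangian T U \<alpha> q v t = restrict_vel \<alpha> T q v t + U q t"

definition velocity :: "(real \<Rightarrow> real^'i::finite) \<Rightarrow> real \<Rightarrow> real^'i" where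
  "velocity q t = vector_derivative q (at t)"

definition free_velocity :: "(real \<Rightarrow> real^('m::finite + 'k::finite)) \<Rightarrow> real \<Rightarrow> real^'m" where
  "free_velocity q t = (\<chi> r. velocity q t $ Inl r)"

definition along ::
  "(real \<Rightarrow> real^('m::finite + 'k::finite)) \<Rightarrow> (real^('m + 'k) \<Rightarrow> real^'m \<Rightarrow> real \<Rightarrow> 'b) \<Rightarrow>
   real \<Rightarrow> 'b" where
  "along q F t = F (q t) (free_velocity q t) t"

text \<open>
  Total time derivatives \<open>d/dt\<close> are \<open>deriv (along q F) t\<close>. Note the order in
  \<open>restrict_vel \<alpha> (D_vel (Inr \<nu>) T)\<close> below: \<open>T\<close> is differentiated first, and
  the constraints are substituted afterwards.
\<close>

definition B_coeff ::
  "(real^('m::finite + 'k::finite) \<Rightarrow> real^'m \<Rightarrow> real \<Rightarrow> real^'k) \<Rightarrow>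
   (real \<Rightarrow> real^('m + 'k)) \<Rightarrow> 'm \<Rightarrow> 'k \<Rightarrow> real \<Rightarrow> real" where
  "B_coeff \<alpha> q r \<nu> t =
     deriv (along q (D_vel r (\<lambda>q v t. \<alpha> q v t $ \<nu>))) t
     - along q (D_pos (Inl r) (\<lambda>q v t. \<alpha> q v t $ \<nu>)) t
     - (\<Sum>\<mu>\<in>UNIV. along q (D_vel r (\<lambda>q v t. \<alpha> q v t $ \<mu>)) t
                 * along q (D_pos (Inr \<mu>) (\<lambda>q v t. \<alpha> q v t $ \<nu>)) t)"

definition alpha_bar ::
  "(real^('m::finite + 'k::finite) \<Rightarrow> real^'m \<Rightarrow> real \<Rightarrow> real^'k) \<Rightarrow>
   'k \<Rightarrow> real^('m + 'k) \<Rightarrow> real^'m \<Rightarrow> real \<Rightarrow> real" where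
  "alpha_bar \<alpha> \<nu> q v t = (\<Sum>r\<in>UNIV. D_vel r (\<lambda>q v t. \<alpha> q v t $ \<nu>) q v t * v $ r)"

definition B_bar ::
  "(real^('m::finite + 'k::finite) \<Rightarrow> real^'m \<Rightarrow> real \<Rightarrow> real^'k) \<Rightarrow>
   (real \<Rightarrow> real^('m + 'k)) \<Rightarrow> 'k \<Rightarrow> real \<Rightarrow> real" where
  "B_bar \<alpha> q \<nu> t = (\<Sum>r\<in>UNIV. B_coeff \<alpha> q r \<nu> t * free_velocity q t $ r)"

definition constraints_at ::
  "(real^('m::finite + 'k::finite) \<Rightarrow> real^'m \<Rightarrow> real \<Rightarrow> real^'k) \<Rightarrow>
   (real \<Rightarrow> real^('m + 'k)) \<Rightarrow> real \<Rightarrow> bool" where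
  "constraints_at \<alpha> q t \<longleftrightarrow> (\<forall>\<nu>. velocity q t $ Inr \<nu> = along q \<alpha> t $ \<nu>)"

definition motion_equations_at ::
  "(real^('m::finite + 'k::finite) \<Rightarrow> real^('m + 'k) \<Rightarrow> real \<Rightarrow> real) \<Rightarrow>
   (real^('m + 'k) \<Rightarrow> real \<Rightarrow> real) \<Rightarrow>
   (real^('m + 'k) \<Rightarrow> real^'m \<Rightarrow> real \<Rightarrow> real^'k) \<Rightarrow>
   (real \<Rightarrow> real^('m + 'k)) \<Rightarrow> real \<Rightarrow> bool" where
  "motion_equations_at T U \<alpha> q t \<longleftrightarrow>
     (let L = restricted_Lagrangian T U \<alpha> in
      \<forall>r. deriv (along q (D_vel (r::'m) L)) t
          - along q (D_pos (Inl r) L) t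
          - (\<Sum>\<nu>\<in>UNIV. along q (D_pos (Inr \<nu>) L) t
                      * along q (D_vel r (\<lambda>q v t. \<alpha> q v t $ \<nu>)) t)
          - (\<Sum>\<nu>\<in>UNIV. B_coeff \<alpha> q r \<nu> t
                      * along q (restrict_vel \<alpha> (D_vel (Inr \<nu>) T)) t) = 0)"

end

theory Submission
  imports Defs
begin

text \<open>
  The chain rule expands the derivative of the energy along the motion; the terms containing
  accelerations cancel. Multiplying the \<open>r\<close>-th equation of motion by the velocity of \<open>q\<^sub>r\<close> and
  summing over \<open>r\<close> replaces the derivatives of the momenta, and the constraints replace the
  dependent velocities.
  Since \<open>U\<close> is only continuously differentiable, the momenta are differentiated by means of the
  explicit formula \<open>T' (G z) (0, join e\<^sub>r (\<alpha>' z (0, e\<^sub>r, 0)), 0)\<close>, where \<open>G\<close> substitutes the constraints.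
\<close>

section \<open>Partial derivatives as values of the total derivative on axis vectors\<close>

lemma has_vector_derivative_vec_update:
  fixes x :: "real^'i::finite"
  shows "((\<lambda>s. \<chi> j. if j = i then s else x $ j) has_vector_derivative axis i 1) (at a)"
proof -
  have "(\<lambda>s. \<chi> j. if j = i then s else x $ j) = (\<lambda>s. x + (s - x $ i) *\<^sub>R axis i 1)"
    by (auto simp: fun_eq_iff vec_eq_iff axis_def)
  then show ?thesis
    by (auto intro!: derivative_eq_intros simp: has_vector_derivative_def)
qed

text \<open>Replacing the \<open>i\<close>-th entry by a parameter gives a curve through
  \<open>x\<close> with velocity \<open>axis i 1\<close>, so the chain rule applies. This ties
  \<open>deriv\<close>, which returns a value even where no derivative exists, to a genuine
  derivative.\<close>

lemma partial_has_derivative: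
  assumes "(f has_derivative f') (at x)"
  shows "partial i f x = f' (axis i 1)"
proof -
  have x: "(\<chi> j. if j = i then x $ i else x $ j) = x"
    by (auto simp: vec_eq_iff)
  have "((\<lambda>s. f (\<chi> j. if j = i then s else x $ j)) has_vector_derivative f' (axis i 1)) (at (x $ i))"
    using vector_derivative_diff_chain_within[OF has_vector_derivative_vec_update[of i x "x $ i"], of f f']
      assms has_derivative_at_withinI unfolding x o_def by blast
  then show ?thesis
    unfolding partial_def has_real_derivative_iff_has_vector_derivative[symmetric]
    by (rule DERIV_imp_deriv)
qed

lemma D_pos_has_derivative:
  assumes "((\<lambda>(x, v, s). F x v s) has_derivative F') (at (q, v, t))"
  shows "D_pos i F q v t = F' (axis i 1, 0, 0)"
proof -
  have "((\<lambda>x. (x, v, t)) has_derivative (\<lambda>h. (h, 0, 0))) (at q)"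
    by (auto intro!: derivative_eq_intros simp: zero_prod_def)
  from has_derivative_compose[OF this assms] show ?thesis
    unfolding D_pos_def by (simp add: partial_has_derivative)
qed

lemma D_vel_has_derivative:
  assumes "((\<lambda>(x, v, s). F x v s) has_derivative F') (at (q, v, t))"
  shows "D_vel j F q v t = F' (0, axis j 1, 0)"
proof -
  have "((\<lambda>w. (q, w, t)) has_derivative (\<lambda>h. (0, h, 0))) (at v)"
    by (auto intro!: derivative_eq_intros)
  from has_derivative_compose[OF this assms] show ?thesis
    unfolding D_vel_def by (simp add: partial_has_derivative)
qed

lemma D_time_has_derivative:
  assumes "((\<lambda>(x, v, s). F x v s) has_derivative F') (at (q, v, t))"
  shows "D_time F q v t = F' (0, 0, 1)"
proof -
  have "((\<lambda>s. (q, v, s)) has_vector_derivative (0, 0, 1)) (at t)"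
    by (auto intro!: derivative_eq_intros simp: has_vector_derivative_def)
  from vector_derivative_diff_chain_within[OF this, of "\<lambda>(x, v, s). F x v s" F'] assms
  have "((\<lambda>s. F q v s) has_vector_derivative F' (0, 0, 1)) (at t)"
    by (auto simp: o_def intro: has_derivative_at_withinI)
  then show ?thesis
    unfolding D_time_def has_real_derivative_iff_has_vector_derivative[symmetric]
    by (rule DERIV_imp_deriv)
qed

lemma linear_eq_sum_axis:
  fixes f :: "real^'i::finite \<Rightarrow> real"
  assumes "linear f"
  shows "f h = (\<Sum>i\<in>UNIV. h $ i * f (axis i 1))"
proof -
  have "f h = f (\<Sum>i\<in>UNIV. h $ i *\<^sub>R axis i 1)"
    by (metis basis_expansion scalar_mult_eq_scaleR)
  also have "\<dots> = (\<Sum>i\<in>UNIV. h $ i * f (axis i 1))"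
    using assms by (simp add: linear_sum linear_scale)
  finally show ?thesis .
qed

text \<open>The form of the total time derivative: a curve in phase space parametrized by time has
  last velocity component 1, and the axis values of \<open>F'\<close> will be the partial
  derivatives.\<close>

lemma linear_phase_expansion:
  fixes F' :: "(real^'i::finite) \<times> (real^'j::finite) \<times> real \<Rightarrow> real"
  assumes "linear F'"
  shows "F' (h, k, 1) = (\<Sum>i\<in>UNIV. h $ i * F' (axis i 1, 0, 0))
           + (\<Sum>j\<in>UNIV. k $ j * F' (0, axis j 1, 0)) + F' (0, 0, 1)"
proof -
  interpret F': linear F' by fact
  have "F' (h, k, 1) = F' ((h, 0, 0) + (0, k, 0) + (0, 0, 1))" by simp
  also have "\<dots> = F' (h, 0, 0) + F' (0, k, 0) + F' (0, 0, 1)" by (simp only: F'.add)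
  finally have split: "F' (h, k, 1) = F' (h, 0, 0) + F' (0, k, 0) + F' (0, 0, 1)" .
  have "linear (\<lambda>h. F' (h, 0, 0))"
    by (rule linearI) (use F'.add[of "(_, 0, 0)" "(_, 0, 0)"] F'.scale[of _ "(_, 0, 0)"] in simp_all)
  moreover have "linear (\<lambda>k. F' (0, k, 0))"
    by (rule linearI) (use F'.add[of "(0, _, 0)" "(0, _, 0)"] F'.scale[of _ "(0, _, 0)"] in simp_all)
  ultimately show ?thesis
    unfolding split by (simp only: linear_eq_sum_axis[of "\<lambda>h. F' (h, 0, 0)" h]
        linear_eq_sum_axis[of "\<lambda>k. F' (0, k, 0)" k])
qed

section \<open>Substitution of the constraints into a function of all velocities\<close>

lemma bounded_linear_join:
  "bounded_linear (\<lambda>p. join (fst p) (snd p :: real^'k::finite) :: real^('m::finite + 'k))"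
  unfolding linear_conv_bounded_linear[symmetric]
  by (rule linearI) (auto simp: join_def vec_eq_iff split: sum.splits)

text \<open>Chain rule for the substitution of \<open>join v (\<alpha> x v s)\<close> for the full
  velocity: a variation of the arguments changes the dependent velocities by
  \<open>\<alpha>' h\<close>.\<close>

lemma has_derivative_restrict_vel:
  assumes \<alpha>: "((\<lambda>(x, v, s). \<alpha> x v s) has_derivative \<alpha>') (at (x, v, s))"
    and T: "((\<lambda>(x, w, s). T x w s) has_derivative T') (at (x, join v (\<alpha> x v s), s))"
  shows "((\<lambda>(x, v, s). restrict_vel \<alpha> T x v s) has_derivative
           (\<lambda>h. T' (fst h, join (fst (snd h)) (\<alpha>' h), snd (snd h)))) (at (x, v, s))"
proof -
  have "((\<lambda>z. (fst (snd z), (\<lambda>(x, v, s). \<alpha> x v s) z)) has_derivative (\<lambda>h. (fst (snd h), \<alpha>' h)))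
      (at (x, v, s))"
    by (intro has_derivative_Pair has_derivative_fst has_derivative_snd has_derivative_ident \<alpha>)
  from bounded_linear.has_derivative[OF bounded_linear_join this]
  have "((\<lambda>z. (fst z, join (fst (snd z)) ((\<lambda>(x, v, s). \<alpha> x v s) z), snd (snd z))) has_derivative
      (\<lambda>h. (fst h, join (fst (snd h)) (\<alpha>' h), snd (snd h)))) (at (x, v, s))"
    by (auto intro!: derivative_eq_intros)
  from has_derivative_compose[OF this, of "\<lambda>(x, w, s). T x w s" T'] T show ?thesis
    by (simp add: restrict_vel_def case_prod_beta')
qed

section \<open>Differentiability of velocities and of derivative maps\<close>

lemma C1_onD: "C1_on S f \<Longrightarrow> x \<in> S \<Longrightarrow> f differentiable (at x)"
  unfolding C1_on_def differentiable_def by blast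

lemma C2_onE:
  assumes "C2_on S f"
  obtains f' where "\<And>x. x \<in> S \<Longrightarrow> (f has_derivative blinfun_apply (f' x)) (at x)"
    and "\<And>x. x \<in> S \<Longrightarrow> f' differentiable (at x)"
  using assms C1_onD unfolding C2_on_def by blast

text \<open>Evaluation of a bounded linear map is bilinear in map and argument, so the product rule
  applies. The momenta have this form, with both factors depending on time.\<close>

lemma differentiable_blinfun_apply:
  assumes "A differentiable (at t)" and "B differentiable (at t)"
  shows "(\<lambda>s. blinfun_apply (A s) (B s)) differentiable (at t)"
  using assms bounded_bilinear.FDERIV[OF bounded_bilinear_blinfun_apply]
  unfolding differentiable_def by blast

lemma differentiable_join:
  assumes "v differentiable (at t)" and "w differentiable (at t)"
  shows "(\<lambda>s. join (v s) (w s)) differentiable (at t)"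
proof -
  from assms obtain v' w' where "(v has_derivative v') (at t)" "(w has_derivative w') (at t)"
    unfolding differentiable_def by blast
  from bounded_linear.has_derivative[OF bounded_linear_join has_derivative_Pair[OF this]]
  show ?thesis
    unfolding differentiable_def by auto
qed

lemma differentiable_Pair:
  assumes "f differentiable (at t)" and "g differentiable (at t)"
  shows "(\<lambda>s. (f s, g s)) differentiable (at t)"
  using assms has_derivative_Pair unfolding differentiable_def by blast

text \<open>A linear map on the reals is determined by its value at 1, so the velocity equals
  \<open>q' s\<close> applied to 1 throughout \<open>I\<close>. Openness of \<open>I\<close> carries
  differentiability over from this expression.\<close>

lemma C2_on_velocity_differentiable:
  assumes "C2_on I q" and "open I" and "t \<in> I"
  shows "velocity q differentiable (at t)"
proof -
  obtain q' where q': "\<And>s. s \<in> I \<Longrightarrow> (q has_derivative blinfun_apply (q' s)) (at s)"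
    and dq': "\<And>s. s \<in> I \<Longrightarrow> q' differentiable (at s)"
    using C2_onE[OF assms(1)] by blast
  have velocity: "velocity q s = blinfun_apply (q' s) 1" if "s \<in> I" for s
  proof -
    have "blinfun_apply (q' s) = (\<lambda>x. x *\<^sub>R blinfun_apply (q' s) 1)"
      by (auto simp flip: blinfun.scaleR_right)
    then show ?thesis
      unfolding velocity_def using q'[OF that]
      by (metis has_vector_derivative_def vector_derivative_at)
  qed
  obtain a where "((\<lambda>s. blinfun_apply (q' s) 1) has_derivative a) (at t)"
    using differentiable_blinfun_apply[OF dq'[OF \<open>t \<in> I\<close>] differentiable_const]
    unfolding differentiable_def by blast
  then have "(velocity q has_derivative a) (at t)"
    using \<open>open I\<close> \<open>t \<in> I\<close> by (rule has_derivative_transform_within_open) (simp add: velocity)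
  then show ?thesis
    unfolding differentiable_def by blast
qed

lemma C2_on_has_velocity:
  assumes "C2_on I q" and "t \<in> I"
  shows "(q has_vector_derivative velocity q t) (at t)"
  using assms unfolding velocity_def vector_derivative_works[symmetric] C2_on_def differentiable_def
  by blast

lemma C2_on_free_velocity_differentiable:
  assumes "C2_on I q" and "open I" and "t \<in> I"
  shows "free_velocity q differentiable (at t)"
proof -
  have "bounded_linear (\<lambda>w :: real^('m::finite + 'k::finite). \<chi> r. w $ Inl r)"
    unfolding linear_conv_bounded_linear[symmetric]
    by (rule linearI) (auto simp: vec_eq_iff)
  from bounded_linear.has_derivative[OF this] C2_on_velocity_differentiable[OF assms]
  show ?thesis
    unfolding differentiable_def free_velocity_def by blast
qed

text \<open>Chain rule along the motion, with \<open>a\<close> the acceleration of the independent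
  coordinates. The position sum runs over all coordinates, and the dependent velocities are not yet
  expressed by the constraints.\<close>

lemma along_has_real_derivative:
  assumes F: "((\<lambda>(x, v, s). F x v s) has_derivative F') (at (q t, free_velocity q t, t))"
    and q: "(q has_vector_derivative velocity q t) (at t)"
    and a: "(free_velocity q has_vector_derivative a) (at t)"
  shows "(along q F has_real_derivative
           (\<Sum>i\<in>UNIV. velocity q t $ i * along q (D_pos i F) t)
           + (\<Sum>r\<in>UNIV. a $ r * along q (D_vel r F) t) + along q (D_time F) t) (at t)"
proof -
  have "((\<lambda>s. (q s, free_velocity q s, s)) has_vector_derivative (velocity q t, a, 1)) (at t)"
    by (intro has_vector_derivative_Pair q a has_vector_derivative_id)
  from vector_derivative_diff_chain_within[OF this, of "\<lambda>(x, v, s). F x v s" F'] F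
  have "(along q F has_vector_derivative F' (velocity q t, a, 1)) (at t)"
    by (auto simp: o_def along_def[abs_def] intro: has_derivative_at_withinI)
  moreover have "F' (velocity q t, a, 1) =
      (\<Sum>i\<in>UNIV. velocity q t $ i * along q (D_pos i F) t)
      + (\<Sum>r\<in>UNIV. a $ r * along q (D_vel r F) t) + along q (D_time F) t"
    using linear_phase_expansion[OF has_derivative_linear[OF F], of "velocity q t" a]
    by (simp add: along_def D_pos_has_derivative[OF F] D_vel_has_derivative[OF F]
        D_time_has_derivative[OF F])
  ultimately show ?thesis
    by (simp add: has_real_derivative_iff_has_vector_derivative)
qed

section \<open>Energy balance along a constrained motion\<close>

theorem proposition2:
  fixes W :: "((real^('m::finite + 'k::finite)) \<times> real) set"
    and D :: "((real^('m + 'k)) \<times> (real^'m) \<times> real) set"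
    and T :: "real^('m + 'k) \<Rightarrow> real^('m + 'k) \<Rightarrow> real \<Rightarrow> real"
    and U :: "real^('m + 'k) \<Rightarrow> real \<Rightarrow> real"
    and \<alpha> :: "real^('m + 'k) \<Rightarrow> real^'m \<Rightarrow> real \<Rightarrow> real^'k"
    and q :: "real \<Rightarrow> real^('m + 'k)"
    and I :: "real set"
  defines "L \<equiv> restricted_Lagrangian T U \<alpha>"
  assumes "open W" and "open D"
    and D_W: "\<And>x v s. (x, v, s) \<in> D \<Longrightarrow> (x, s) \<in> W"
    and T: "C2_on {(x, w, s). (x, s) \<in> W} (\<lambda>(x, w, s). T x w s)"
    and U: "C1_on W (\<lambda>(x, s). U x s)"
    and \<alpha>: "C2_on D (\<lambda>(x, v, s). \<alpha> x v s)"
    and "open I" and "is_interval I"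
    and q: "C2_on I q"
    and q_D: "\<And>s. s \<in> I \<Longrightarrow> (q s, free_velocity q s, s) \<in> D"
    and constraints: "\<And>s. s \<in> I \<Longrightarrow> constraints_at \<alpha> q s"
    and motion: "\<And>s. s \<in> I \<Longrightarrow> motion_equations_at T U \<alpha> q s"
    and "t \<in> I"
  shows "((\<lambda>s. (\<Sum>r\<in>UNIV. free_velocity q s $ r * along q (D_vel r L) s) - along q L s)
           has_real_derivative
             - along q (D_time L) t
             + (\<Sum>\<nu>\<in>UNIV. (along q (alpha_bar \<alpha> \<nu>) t - along q \<alpha> t $ \<nu>)
                         * along q (D_pos (Inr \<nu>) L) t)
             + (\<Sum>\<nu>\<in>UNIV. B_bar \<alpha> q \<nu> t
                         * along q (restrict_vel \<alpha> (D_vel (Inr \<nu>) T)) t)) (at t)"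
proof -
  obtain T' where T': "\<And>x w s. (x, s) \<in> W \<Longrightarrow>
        ((\<lambda>(x, w, s). T x w s) has_derivative blinfun_apply (T' (x, w, s))) (at (x, w, s))"
    and dT': "\<And>x w s. (x, s) \<in> W \<Longrightarrow> T' differentiable (at (x, w, s))"
    by (rule C2_onE[OF T]) auto
  obtain \<alpha>' where \<alpha>': "\<And>z. z \<in> D \<Longrightarrow>
        ((\<lambda>(x, v, s). \<alpha> x v s) has_derivative blinfun_apply (\<alpha>' z)) (at z)"
    and d\<alpha>': "\<And>z. z \<in> D \<Longrightarrow> \<alpha>' differentiable (at z)"
    using C2_onE[OF \<alpha>] by blast
  define G where "G = (\<lambda>(x, v, s). (x, join v (\<alpha> x v s), s))"
  \<comment> \<open>The maps \<open>T'\<close> and \<open>\<alpha>'\<close> are fixed once for all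
    points, so that they can be differentiated along the motion later; \<open>U'\<close> is chosen
    separately at each point.\<close>
  have L_deriv: "\<exists>U'. bounded_linear U' \<and> ((\<lambda>(x, v, s). L x v s) has_derivative
      (\<lambda>h. blinfun_apply (T' (G (x, v, s)))
              (fst h, join (fst (snd h)) (blinfun_apply (\<alpha>' (x, v, s)) h), snd (snd h))
           + U' (fst h, snd (snd h)))) (at (x, v, s))"
    if xD: "(x, v, s) \<in> D" for x v s
  proof -
    obtain U' where U': "((\<lambda>(x, s). U x s) has_derivative U') (at (x, s))"
      using C1_onD[OF U D_W[OF xD]] unfolding differentiable_def by blast
    have "((\<lambda>z. (fst z, snd (snd z))) has_derivative (\<lambda>h. (fst h, snd (snd h)))) (at (x, v, s))"
      by (auto intro!: derivative_eq_intros)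
    from has_derivative_compose[OF this, of "\<lambda>(x, s). U x s" U'] U'
    have "((\<lambda>z. U (fst z) (snd (snd z))) has_derivative (\<lambda>h. U' (fst h, snd (snd h))))
        (at (x, v, s))"
      by simp
    from has_derivative_add[OF has_derivative_restrict_vel[OF \<alpha>'[OF xD] T'[OF D_W[OF xD]]] this]
    show ?thesis
      using has_derivative_bounded_linear[OF U']
      by (auto simp: L_def restricted_Lagrangian_def G_def case_prod_beta')
  qed
  have q_vel: "(q has_vector_derivative velocity q t) (at t)"
    using C2_on_has_velocity[OF q \<open>t \<in> I\<close>] .
  have d_vel: "free_velocity q differentiable (at t)"
    using C2_on_free_velocity_differentiable[OF q \<open>open I\<close> \<open>t \<in> I\<close>] .
  then obtain a where a: "(free_velocity q has_vector_derivative a) (at t)"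
    by (auto simp: vector_derivative_works)
  define z where "z = (\<lambda>s. (q s, free_velocity q s, s))"
  have dz: "z differentiable (at t)"
    unfolding z_def using q_vel d_vel
    by (intro differentiable_Pair) (auto simp: differentiableI_vector)
  have zD: "z s \<in> D" if "s \<in> I" for s
    using q_D[OF that] by (simp add: z_def)
  have qtW: "(q t, t) \<in> W"
    using D_W q_D \<open>t \<in> I\<close> by blast
  \<comment> \<open>The variation \<open>(0, axis r 1, 0)\<close> changes neither position nor time,
    so \<open>U\<close> contributes \<open>U' (0, 0) = 0\<close> and disappears from the
    formula.\<close>
  have momentum: "along q (D_vel r L) s = blinfun_apply (T' (G (z s)))
      (0, join (axis r 1) (blinfun_apply (\<alpha>' (z s)) (0, axis r 1, 0)), 0)"
    if s: "s \<in> I" for r s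
  proof -
    obtain U' where "bounded_linear U'"
      and *: "((\<lambda>(x, v, s). L x v s) has_derivative
      (\<lambda>h. blinfun_apply (T' (G (z s)))
              (fst h, join (fst (snd h)) (blinfun_apply (\<alpha>' (z s)) h), snd (snd h))
           + U' (fst h, snd (snd h)))) (at (q s, free_velocity q s, s))"
      using L_deriv[OF q_D[OF s]] unfolding z_def by blast
    then have "U' (0, 0) = 0"
      by (metis bounded_linear.linear linear_0 zero_prod_def)
    then show ?thesis
      unfolding along_def D_vel_has_derivative[OF *] by simp
  qed
  \<comment> \<open>The equations of motion only prescribe a value of \<open>deriv\<close>, which
    does not imply differentiability. It comes from the formula above, where \<open>T'\<close>,
    \<open>\<alpha>'\<close> and \<open>\<alpha>\<close> are composed with differentiable
    curves.\<close>
  have d_momentum: "along q (D_vel r L) differentiable (at t)" for r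
  proof -
    have "(\<lambda>s. \<alpha>' (z s)) differentiable (at t)"
      by (rule differentiable_compose[of \<alpha>' z, OF d\<alpha>'[OF zD[OF \<open>t \<in> I\<close>]] dz])
    then have 1: "(\<lambda>s. (0::real^('m + 'k), join (axis r 1)
        (blinfun_apply (\<alpha>' (z s)) (0, axis r 1, 0)), 0::real)) differentiable (at t)"
      by (intro differentiable_Pair differentiable_join differentiable_blinfun_apply
          differentiable_const)
    have "(\<lambda>s. (\<lambda>(x, v, s). \<alpha> x v s) (z s)) differentiable (at t)"
      using differentiable_compose[of "\<lambda>(x, v, s). \<alpha> x v s" z, OF _ dz] \<alpha>'[OF zD[OF \<open>t \<in> I\<close>]]
      unfolding differentiable_def by blast
    then have "(\<lambda>s. \<alpha> (q s) (free_velocity q s) s) differentiable (at t)"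
      by (simp add: z_def)
    then have "(\<lambda>s. G (z s)) differentiable (at t)"
      unfolding G_def z_def prod.case using q_vel d_vel
      by (intro differentiable_Pair differentiable_join) (auto simp: differentiableI_vector)
    moreover have "T' differentiable (at (G (z t)))"
      using dT'[OF qtW] by (simp add: G_def z_def)
    ultimately have "(\<lambda>s. T' (G (z s))) differentiable (at t)"
      using differentiable_compose[of T' "\<lambda>s. G (z s)"] by blast
    from differentiable_blinfun_apply[OF this 1] obtain p' where
      "((\<lambda>s. blinfun_apply (T' (G (z s))) (0, join (axis r 1)
        (blinfun_apply (\<alpha>' (z s)) (0, axis r 1, 0)), 0)) has_derivative p') (at t)"
      unfolding differentiable_def by blast
    then have "(along q (D_vel r L) has_derivative p') (at t)"
      using \<open>open I\<close> \<open>t \<in> I\<close>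
      by (rule has_derivative_transform_within_open) (simp add: momentum)
    then show ?thesis
      unfolding differentiable_def by blast
  qed
  let ?v = "free_velocity q t"
  let ?p = "\<lambda>r. along q (D_vel r L) t"
  let ?p' = "\<lambda>r. deriv (along q (D_vel r L)) t"
  let ?P = "\<lambda>\<nu>. along q (D_pos (Inr \<nu>) L) t"
  let ?A = "\<lambda>\<nu> r. along q (D_vel r (\<lambda>q v t. \<alpha> q v t $ \<nu>)) t"
  let ?S = "\<lambda>\<nu>. along q (restrict_vel \<alpha> (D_vel (Inr \<nu>) T)) t"
  obtain L' where "((\<lambda>(x, v, s). L x v s) has_derivative L') (at (q t, ?v, t))"
    using L_deriv[OF q_D[OF \<open>t \<in> I\<close>]] by blast
  note dL = along_has_real_derivative[OF this q_vel a]
  have dp: "(along q (D_vel r L) has_real_derivative ?p' r) (at t)" for r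
    using d_momentum DERIV_deriv_iff_real_differentiable by blast
  have dv: "((\<lambda>s. free_velocity q s $ r) has_real_derivative a $ r) (at t)" for r
    using bounded_linear.has_vector_derivative[OF bounded_linear_vec_nth a]
    by (simp add: has_real_derivative_iff_has_vector_derivative)
  \<comment> \<open>Product rule for the first sum, chain rule for \<open>L\<close>. The sum of
    \<open>a $ r * ?p r\<close> occurs in both with opposite signs, so the accelerations will
    cancel.\<close>
  have "((\<lambda>s. (\<Sum>r\<in>UNIV. free_velocity q s $ r * along q (D_vel r L) s) - along q L s)
      has_real_derivative
      (\<Sum>r\<in>UNIV. a $ r * ?p r + ?p' r * ?v $ r)
      - ((\<Sum>i\<in>UNIV. velocity q t $ i * along q (D_pos i L) t)
         + (\<Sum>r\<in>UNIV. a $ r * ?p r) + along q (D_time L) t)) (at t)"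
    by (intro DERIV_diff DERIV_sum DERIV_mult dv dp dL)
  \<comment> \<open>The \<open>r\<close>-th equation of motion, solved for the derivative of the
    momentum.\<close>
  moreover have "?p' r = along q (D_pos (Inl r) L) t + (\<Sum>\<nu>\<in>UNIV. ?P \<nu> * ?A \<nu> r)
      + (\<Sum>\<nu>\<in>UNIV. B_coeff \<alpha> q r \<nu> t * ?S \<nu>)" for r
    using motion[OF \<open>t \<in> I\<close>] unfolding motion_equations_at_def Let_def L_def[symmetric]
    by (auto simp: algebra_simps dest: spec[of _ r])
  then have "(\<Sum>r\<in>UNIV. ?p' r * ?v $ r) =
      (\<Sum>r\<in>UNIV. ?v $ r * along q (D_pos (Inl r) L) t)
      + (\<Sum>r\<in>UNIV. \<Sum>\<nu>\<in>UNIV. ?P \<nu> * ?A \<nu> r * ?v $ r)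
      + (\<Sum>r\<in>UNIV. \<Sum>\<nu>\<in>UNIV. B_coeff \<alpha> q r \<nu> t * ?S \<nu> * ?v $ r)"
    by (simp add: sum.distrib sum_distrib_left algebra_simps)
  \<comment> \<open>Once the order of summation is exchanged, the inner sums over \<open>r\<close>
    are exactly \<open>alpha_bar\<close> here and \<open>B_bar\<close> in the next identity.\<close>
  moreover have "(\<Sum>r\<in>UNIV. \<Sum>\<nu>\<in>UNIV. ?P \<nu> * ?A \<nu> r * ?v $ r)
      = (\<Sum>\<nu>\<in>UNIV. along q (alpha_bar \<alpha> \<nu>) t * ?P \<nu>)"
    by (subst sum.swap) (simp add: along_def alpha_bar_def sum_distrib_left sum_distrib_right mult_ac)
  moreover have "(\<Sum>r\<in>UNIV. \<Sum>\<nu>\<in>UNIV. B_coeff \<alpha> q r \<nu> t * ?S \<nu> * ?v $ r)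
      = (\<Sum>\<nu>\<in>UNIV. B_bar \<alpha> q \<nu> t * ?S \<nu>)"
    by (subst sum.swap) (simp add: B_bar_def sum_distrib_left sum_distrib_right mult_ac)
  \<comment> \<open>Splitting the index type separates the two kinds of velocities. The
    \<open>Inl\<close> part cancels against the equations of motion; the \<open>Inr\<close> part,
    rewritten by the constraints, supplies the \<open>\<alpha>\<close> subtracted from
    \<open>alpha_bar\<close>.\<close>
  moreover have "(\<Sum>i\<in>UNIV. velocity q t $ i * along q (D_pos i L) t)
      = (\<Sum>r\<in>UNIV. ?v $ r * along q (D_pos (Inl r) L) t) + (\<Sum>\<nu>\<in>UNIV. along q \<alpha> t $ \<nu> * ?P \<nu>)"
    using constraints[OF \<open>t \<in> I\<close>]
    by (subst UNIV_Plus_UNIV[symmetric], subst sum.Plus)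
      (simp_all add: free_velocity_def constraints_at_def)
  ultimately show ?thesis
    by (simp add: sum.distrib left_diff_distrib sum_subtractf algebra_simps)
qed

end
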